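(* Let $\beta\in C^1(\mathbb R_+)$ and put $\beta_n=\beta(n)$ for $n\in\mathbb N$. Let $\mu>0$ and assume that $$\lim_{n\to\infty}\frac{|\beta_n|^{\frac1{\mu n}}}{n}<\frac{\mu}{e}.$$ Then, for $\mu,\eta$ such that $\min\{\eta+\tfrac32,\ \mu+\eta+1\}>0$ and $$x\in\left(0,\ 2\min\left(1,\left(\left(\tfrac{e}{\mu}\right)^{\mu}\limsup_{n\to\infty}n^{-\mu}|\beta_n|^{1/n}\right)^{-1}\right)\right),$$ one has the integral representation $$\sum_{n\ge1}\beta_n I_{\mu n+\eta}(x)=-\int_1^\infty\int_0^{[u]}\frac{\partial}{\partial u}\Big(\Gamma\big(\mu u+\eta+\tfrac12\big)I_{\mu u+\eta}(x)\Big)\,\mathfrak d_s\left(\frac{\beta(s)}{\Gamma\left(\mu s+\eta+\frac12\right)}\right)\mathrm du\,\mathrm ds .$$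
   Context: $I_\nu(x)=\sum_{n\ge0}\frac{(x/2)^{2n+\nu}}{\Gamma(n+\nu+1)\,n!}$ is the modified Bessel function of the first kind. $\mathbb R_+$ is the half-line $[0,\infty)$. $[x]$ and $\{x\}=x-[x]$ denote the integer and fractional part of a real number $x$. The operator $\mathfrak d_s$ is $\mathfrak d_s=1+\{s\}\frac{\mathrm d}{\mathrm ds}$, i.e. $\mathfrak d_s f(s)=f(s)+\{s\}f'(s)$. In the double integral, $u$ runs over $(1,\infty)$ and, for each $u$, $s$ runs over $(0,[u])$. In the description of the range of $x$, $1/0$ is read as $+\infty$.
   Formalization: Added assumption: μu+η+1/2 is not a pole of Γ for any u≥1 (equivalently μ+η+1/2>0); without it the claim fails, e.g. μ=1/2, η=−1, β(1)=1, β(n)=0 for other n, where the left side is I_{−1/2}(x)>0 and the right side is 0. *)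

theory Defs
  imports "HOL-Analysis.Analysis"
begin

text \<open>
  At a pole of \<open>Gamma\<close> the library has \<open>Gamma z = 0\<close> and hence \<open>y / Gamma z = 0\<close>, which agrees
  with the value there of the entire function \<open>1 / Gamma\<close>. Real powers are taken with
  \<open>powr\<close>, so the series is meant for \<open>x > 0\<close>.
\<close>
definition bessel_I :: "real \<Rightarrow> real \<Rightarrow> real" where
  "bessel_I \<nu> x = (\<Sum>n. (x / 2) powr (2 * real n + \<nu>) / (Gamma (real n + \<nu> + 1) * fact n))"

text \<open>One-sided derivative at \<open>0\<close>: values of \<open>f\<close> on the negative half-line are irrelevant.\<close>
definition C1_halfline :: "(real \<Rightarrow> real) \<Rightarrow> bool" where
  "C1_halfline f \<longleftrightarrow>
     (\<exists>f'. (\<forall>s\<ge>0. (f has_real_derivative f' s) (at s within {0..})) \<and> continuous_on {0..} f')"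

definition dd :: "(real \<Rightarrow> real) \<Rightarrow> real \<Rightarrow> real" where
  "dd f s = f s + frac s * deriv f s"

end

theory Submission
  imports Defs "HOL-Complex_Analysis.Complex_Analysis" "HOL-Real_Asymp.Real_Asymp"
begin

text \<open>
  Write \<open>F u = Gamma (\<mu> u + \<eta> + 1/2) I\<^bsub>\<mu>u + \<eta>\<^esub>(x)\<close> and \<open>a s = \<beta> s / Gamma (\<mu> s + \<eta> + 1/2)\<close>. On each
  \<open>[k, k + 1]\<close> the integrand \<open>dd a\<close> is the derivative of \<open>(s - k) a s\<close>, so its integral over
  \<open>(0, [u])\<close> is the partial sum \<open>A [u]\<close> of the \<open>a k\<close>, and the claim is Abel summation.
  The growth assumption \<open>L < \<mu> / e\<close> and \<open>Gamma (w + 1) \<ge> (w / e)\<^sup>w\<close> make \<open>\<Sum> a k\<close> absolutely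
  convergent, so that \<open>A\<close> is bounded. Since \<open>x < 2\<close>, every term of the Bessel series
  times \<open>Gamma (\<nu> + 1/2)\<close> decreases in \<open>\<nu>\<close>, hence \<open>F\<close> decreases to \<open>0\<close> and
  \<open>F'\<close> is absolutely integrable. The assumption that \<open>\<mu> u + \<eta> + 1/2\<close> avoids the poles of \<open>Gamma\<close>
  for all \<open>u \<ge> 1\<close> forces it to be positive there. Smoothness of \<open>F\<close> comes from holomorphy
  in the order \<open>\<nu>\<close>.
\<close>

section \<open>Estimates for the real Gamma function\<close>

text \<open>Discard the part of Euler's integral below \<open>w\<close>. On the rest
  \<open>t powr w\<close> is at least \<open>w powr w\<close>, and \<open>exp (-t)\<close>
  integrates to \<open>exp (-w)\<close> there.\<close>

lemma Gamma_plus1_ge: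
  fixes w :: real
  assumes "w > 0"
  shows "w powr w / exp w \<le> Gamma (w + 1)"
proof -
  have G: "((\<lambda>t. t powr w / exp t) has_integral Gamma (w + 1)) {0..}"
    using Gamma_integral_real[of "w + 1"] assms by simp
  have E: "((\<lambda>t. w powr w * exp (-1 * t)) has_integral w powr w * (exp (-1 * w) / 1)) {w..}"
    by (intro has_integral_mult_right has_integral_exp_minus_to_infinity) simp
  have E': "((\<lambda>t. if t \<in> {w..} then w powr w * exp (-1 * t) else 0) has_integral
      w powr w * (exp (-1 * w) / 1)) {0..}"
    using assms E by (subst has_integral_restrict) auto
  have "w powr w * (exp (-1 * w) / 1) \<le> Gamma (w + 1)"
  proof (rule has_integral_le[OF E' G])
    fix t :: real assume "t \<in> {0..}"
    then show "(if t \<in> {w..} then w powr w * exp (-1 * t) else 0) \<le> t powr w / exp t"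
      using assms by (auto simp: exp_minus field_simps intro!: powr_mono2)
  qed
  then show ?thesis by (simp add: exp_minus field_simps)
qed

text \<open>The logarithmic derivative of the quotient is
  \<open>Digamma t - Digamma (t + c)\<close>, which is not positive because \<open>Digamma\<close>
  increases on the positive axis.\<close>

lemma Gamma_ratio_antimono:
  fixes a b c :: real
  assumes "0 < a" "a \<le> b" "0 \<le> c"
  shows "Gamma b / Gamma (b + c) \<le> Gamma a / Gamma (a + c)"
proof (rule DERIV_nonpos_imp_nonincreasing[OF \<open>a \<le> b\<close>])
  fix t assume t: "a \<le> t" "t \<le> b"
  then have pos: "t > 0" "t + c > 0" using assms by auto
  have np: "t \<notin> \<int>\<^sub>\<le>\<^sub>0" "t + c \<notin> \<int>\<^sub>\<le>\<^sub>0" using pos by (auto elim!: nonpos_Ints_cases)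
  have "Digamma t \<le> Digamma (t + c)"
    using pos assms by (intro Digamma_real_mono) auto
  then have "Gamma t / Gamma (t + c) * (Digamma t - Digamma (t + c)) \<le> 0"
    using Gamma_real_pos[of t] Gamma_real_pos[of "t + c"] pos
    by (intro mult_nonneg_nonpos) auto
  moreover have "((\<lambda>t. Gamma t / Gamma (t + c)) has_real_derivative
      Gamma t / Gamma (t + c) * (Digamma t - Digamma (t + c))) (at t)"
    using np Gamma_real_pos[OF pos(2)]
    by (auto intro!: derivative_eq_intros simp: field_simps power2_eq_square)
  ultimately show "\<exists>y. ((\<lambda>t. Gamma t / Gamma (t + c)) has_real_derivative y) (at t) \<and> y \<le> 0"
    by blast
qed

section \<open>Smooth dependence of the Bessel function on its order\<close>

text \<open>By the functional equation, \<open>rGamma w = w * rGamma (w + 1)\<close>, and here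
  \<open>norm w\<close> is at least 1/2, so each shift costs at most a factor 2. The resulting
  \<open>2 ^ n\<close> is harmless against the \<open>fact n\<close> of the Bessel series.\<close>

lemma norm_rGamma_shift_le:
  fixes z :: complex
  assumes "Re z > - 1/2"
  shows "norm (rGamma (z + of_nat n + 1)) \<le> 2 ^ n * norm (rGamma (z + 1))"
proof (induction n)
  case (Suc n)
  let ?w = "z + of_nat n + 1"
  have "1 / 2 \<le> norm ?w"
    using assms complex_Re_le_cmod[of ?w] by simp
  then have "norm (rGamma (?w + 1)) \<le> 2 * (norm ?w * norm (rGamma (?w + 1)))"
    using mult_right_mono[of "1/2" "norm ?w" "norm (rGamma (?w + 1))"] by simp
  also have "\<dots> = 2 * norm (rGamma ?w)"
    by (simp only: rGamma_plus1 norm_mult [symmetric])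
  finally show ?case using Suc by (simp add: add_ac)
qed simp

lemma summable_rGamma_power:
  fixes z :: complex
  assumes "Re z > - 1/2"
  shows "summable (\<lambda>n. rGamma (z + of_nat n + 1) * of_real (y ^ n / fact n))"
proof (rule summable_comparison_test)
  show "\<exists>N. \<forall>n\<ge>N. norm (rGamma (z + of_nat n + 1) * of_real (y ^ n / fact n))
      \<le> norm (rGamma (z + 1)) * ((2 * \<bar>y\<bar>) ^ n /\<^sub>R fact n)"
    using mult_right_mono[OF norm_rGamma_shift_le[OF assms], of "\<bar>y\<bar> ^ n / fact n" for n]
    by (auto simp: norm_mult norm_divide norm_power power_mult_distrib field_simps)
  show "summable (\<lambda>n. norm (rGamma (z + 1)) * ((2 * \<bar>y\<bar>) ^ n /\<^sub>R fact n))"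
    by (intro summable_mult summable_exp_generic)
qed

text \<open>The terms are entire because \<open>rGamma\<close> is. On a closed ball
  \<open>rGamma (z + 1)\<close> is bounded by compactness, so an exponential series dominates and
  the convergence is locally uniform.\<close>

lemma holomorphic_rGamma_power_series:
  "(\<lambda>z::complex. \<Sum>n. rGamma (z + of_nat n + 1) * of_real (y ^ n / fact n))
     holomorphic_on {z. Re z > - 1/2}" (is "?g holomorphic_on ?S")
proof (rule holomorphic_uniform_sequence)
  show "open ?S" by (rule open_halfspace_Re_gt)
  show "(\<lambda>z. \<Sum>k<n. rGamma (z + of_nat k + 1) * of_real (y ^ k / fact k)) holomorphic_on ?S" for n
    by (auto intro!: holomorphic_intros)
  fix z assume "z \<in> ?S"
  then obtain d where d: "d > 0" "cball z d \<subseteq> ?S"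
    using open_contains_cball[of ?S] open_halfspace_Re_gt[of "- 1/2"] by auto
  have "compact ((\<lambda>z. rGamma (z + 1)) ` cball z d)"
    by (intro compact_continuous_image continuous_on_compose2[OF continuous_on_rGamma[of UNIV]]
        continuous_intros) auto
  then obtain C where C: "\<And>w. w \<in> cball z d \<Longrightarrow> norm (rGamma (w + 1)) \<le> C"
    by (meson bounded_iff compact_imp_bounded imageI)
  have "uniform_limit (cball z d)
      (\<lambda>n z. \<Sum>k<n. rGamma (z + of_nat k + 1) * of_real (y ^ k / fact k)) ?g sequentially"
  proof (rule Weierstrass_m_test)
    fix n w assume w: "w \<in> cball z d"
    have "norm (rGamma (w + of_nat n + 1)) \<le> 2 ^ n * norm (rGamma (w + 1))"
      using w d by (intro norm_rGamma_shift_le) auto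
    also have "\<dots> \<le> 2 ^ n * C" using C[OF w] by simp
    finally have "norm (rGamma (w + of_nat n + 1)) * (\<bar>y\<bar> ^ n / fact n)
        \<le> 2 ^ n * C * (\<bar>y\<bar> ^ n / fact n)"
      by (rule mult_right_mono) simp
    then show "norm (rGamma (w + of_nat n + 1) * of_real (y ^ n / fact n))
        \<le> C * ((2 * \<bar>y\<bar>) ^ n /\<^sub>R fact n)"
      by (simp add: norm_mult norm_divide norm_power power_mult_distrib field_simps)
  next
    show "summable (\<lambda>n. C * ((2 * \<bar>y\<bar>) ^ n /\<^sub>R fact n))"
      by (intro summable_mult summable_exp_generic)
  qed
  with d show "\<exists>d>0. cball z d \<subseteq> ?S \<and> uniform_limit (cball z d)
      (\<lambda>n z. \<Sum>k<n. rGamma (z + of_nat k + 1) * of_real (y ^ k / fact k)) ?g sequentially"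
    by blast
qed

text \<open>Pulling \<open>(x/2) powr \<nu>\<close> out of the series as an exponential leaves a
  power series in \<open>(x/2)\<^sup>2\<close> whose coefficients also make sense for complex
  order.\<close>

lemma
  fixes \<nu> x :: real
  assumes "\<nu> > - 1/2" "x > 0"
  shows summable_bessel_I:
      "summable (\<lambda>n. (x/2) powr (2 * real n + \<nu>) / (Gamma (real n + \<nu> + 1) * fact n))"
    and complex_of_real_bessel_I: "complex_of_real (bessel_I \<nu> x) = exp (of_real \<nu> * of_real (ln (x/2))) *
      (\<Sum>n. rGamma (of_real \<nu> + of_nat n + 1) * of_real (((x/2)\<^sup>2) ^ n / fact n))"
proof -
  define t where "t n = rGamma (complex_of_real \<nu> + of_nat n + 1) * of_real (((x/2)\<^sup>2) ^ n / fact n)" for n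
  have t: "summable t"
    unfolding t_def using assms by (intro summable_rGamma_power) auto
  have eq: "complex_of_real ((x/2) powr (2 * real n + \<nu>) / (Gamma (real n + \<nu> + 1) * fact n)) =
      exp (of_real \<nu> * of_real (ln (x/2))) * t n" for n
  proof -
    have "(x/2) powr (2 * real n + \<nu>) = exp (\<nu> * ln (x/2)) * ((x/2)\<^sup>2) ^ n"
      using assms powr_realpow[of "x/2" "2 * n"] by (simp add: powr_add power_mult powr_def[of _ \<nu>])
    moreover have "rGamma (complex_of_real \<nu> + of_nat n + 1) = of_real (rGamma (real n + \<nu> + 1))"
      by (simp add: rGamma_complex_of_real[symmetric] add_ac)
    moreover have "exp (of_real \<nu> * of_real (ln (x/2))) = complex_of_real (exp (\<nu> * ln (x/2)))"
      by (simp flip: exp_of_real)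
    ultimately show ?thesis
      by (simp only: t_def) (simp add: rGamma_inverse_Gamma field_simps)
  qed
  have s: "summable (\<lambda>n. complex_of_real ((x/2) powr (2 * real n + \<nu>) / (Gamma (real n + \<nu> + 1) * fact n)))"
    unfolding eq by (intro summable_mult t)
  then show *: "summable (\<lambda>n. (x/2) powr (2 * real n + \<nu>) / (Gamma (real n + \<nu> + 1) * fact n))"
    by (simp only: summable_complex_of_real)
  show "complex_of_real (bessel_I \<nu> x) = exp (of_real \<nu> * of_real (ln (x/2))) *
      (\<Sum>n. rGamma (of_real \<nu> + of_nat n + 1) * of_real (((x/2)\<^sup>2) ^ n / fact n))"
    unfolding bessel_I_def suminf_of_real[OF *] eq t_def[symmetric]
    by (rule suminf_mult[OF t])
qed

text \<open>Transfers holomorphy to the real axis: the real part of a holomorphic function,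
  restricted to real arguments, is continuously differentiable.\<close>

lemma
  fixes f :: "complex \<Rightarrow> complex" and t :: real
  assumes hol: "f holomorphic_on S" and "open S" and t: "of_real t \<in> S"
  shows has_real_derivative_Re_of_real:
      "((\<lambda>t. Re (f (of_real t))) has_real_derivative Re (deriv f (of_real t))) (at t)"
    and isCont_Re_deriv_of_real: "isCont (\<lambda>t. Re (deriv f (of_real t))) t"
proof -
  have "(f has_field_derivative deriv f (of_real t)) (at (of_real t))"
    using assms by (rule holomorphic_derivI)
  then have "((\<lambda>t. f (of_real t)) has_vector_derivative deriv f (of_real t)) (at t)"
    by (rule has_vector_derivative_real_field)
  then show "((\<lambda>t. Re (f (of_real t))) has_real_derivative Re (deriv f (of_real t))) (at t)"
    unfolding has_real_derivative_iff_has_vector_derivative has_vector_derivative_def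
    by (drule_tac has_derivative_Re) simp
  have "isCont (deriv f) (of_real t)"
    using holomorphic_deriv[OF hol \<open>open S\<close>] \<open>open S\<close> t
    by (metis continuous_on_eq_continuous_at holomorphic_on_imp_continuous_on)
  then have "isCont (\<lambda>t. deriv f (of_real t)) t"
    by (rule isCont_o2[rotated]) (intro continuous_of_real continuous_ident)
  then show "isCont (\<lambda>t. Re (deriv f (of_real t))) t"
    by (rule continuous_Re)
qed

text \<open>The function of the order extends holomorphically to a half-plane, and the real part of
  the complex derivative serves as \<open>\<phi>'\<close>.\<close>

lemma Gamma_bessel_I_C1:
  fixes x :: real
  assumes "x > 0"
  obtains \<phi>' where "\<And>\<nu>. \<nu> > - 1/2 \<Longrightarrow>
      ((\<lambda>\<nu>. Gamma (\<nu> + 1/2) * bessel_I \<nu> x) has_real_derivative \<phi>' \<nu>) (at \<nu>)"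
    and "\<And>\<nu>. \<nu> > - 1/2 \<Longrightarrow> isCont \<phi>' \<nu>"
proof -
  let ?S = "{z. Re z > - 1/2}"
  define \<Phi> where "\<Phi> z = Gamma (z + 1/2) * (exp (z * of_real (ln (x/2))) *
     (\<Sum>n. rGamma (z + of_nat n + 1) * of_real (((x/2)\<^sup>2) ^ n / fact n)))" for z :: complex
  have opn: "open ?S" by (rule open_halfspace_Re_gt)
  have hol: "\<Phi> holomorphic_on ?S"
    unfolding \<Phi>_def
    \<comment> \<open>The poles of \<open>Gamma (z + 1/2)\<close> are avoided since
      \<open>z + 1/2\<close> has positive real part.\<close>
    by (intro holomorphic_intros holomorphic_rGamma_power_series)
       (auto elim!: nonpos_Ints_cases simp: complex_eq_iff)
  have eq: "\<Phi> (of_real \<nu>) = of_real (Gamma (\<nu> + 1/2) * bessel_I \<nu> x)" if "\<nu> > - 1/2" for \<nu>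
    using complex_of_real_bessel_I[OF that assms] Gamma_complex_of_real[of "\<nu> + 1/2"]
    by (simp add: \<Phi>_def)
  show thesis
  proof
    fix \<nu> :: real assume \<nu>: "\<nu> > - 1/2"
    then have \<nu>': "of_real \<nu> \<in> ?S" by simp
    show "((\<lambda>\<nu>. Gamma (\<nu> + 1/2) * bessel_I \<nu> x) has_real_derivative Re (deriv \<Phi> (of_real \<nu>))) (at \<nu>)"
      using has_real_derivative_Re_of_real[OF hol opn \<nu>']
      by (rule has_field_derivative_transform_within_open[where S = "{- 1/2<..}"])
         (use \<nu> eq in auto)
    show "isCont (\<lambda>\<nu>. Re (deriv \<Phi> (of_real \<nu>))) \<nu>"
      by (rule isCont_Re_deriv_of_real[OF hol opn \<nu>'])
  qed
qed

section \<open>Sign and decay in the order\<close>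

lemma Gamma_bessel_I_nonneg:
  assumes "\<nu> > - 1/2" "x > 0"
  shows "0 \<le> Gamma (\<nu> + 1/2) * bessel_I \<nu> x"
  unfolding bessel_I_def using assms
  by (intro mult_nonneg_nonneg suminf_nonneg summable_bessel_I) (auto intro!: divide_nonneg_nonneg Gamma_real_nonneg)

text \<open>The comparison is termwise: with \<open>t = \<nu> + 1/2\<close> the Gamma factors form
  the quotient \<open>Gamma t / Gamma (t + n + 1/2)\<close>, which decreases in \<open>t\<close>,
  and the powers of \<open>x/2\<close> differ by the factor shown. For \<open>x < 2\<close> this
  yields both monotonicity and exponential decay.\<close>

lemma Gamma_bessel_I_decay:
  assumes "- 1/2 < \<nu>" "\<nu> \<le> \<nu>'" "x > 0"
  shows "Gamma (\<nu>' + 1/2) * bessel_I \<nu>' x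
      \<le> (x/2) powr (\<nu>' - \<nu>) * (Gamma (\<nu> + 1/2) * bessel_I \<nu> x)"
proof -
  have pos: "x / 2 > 0" "\<nu>' > - 1/2" using assms by auto
  note s = summable_bessel_I[OF assms(1,3)] summable_bessel_I[OF pos(2) assms(3)]
  have "(\<Sum>n. Gamma (\<nu>' + 1/2) * ((x/2) powr (2 * real n + \<nu>') / (Gamma (real n + \<nu>' + 1) * fact n)))
     \<le> (\<Sum>n. (x/2) powr (\<nu>' - \<nu>) *
          (Gamma (\<nu> + 1/2) * ((x/2) powr (2 * real n + \<nu>) / (Gamma (real n + \<nu> + 1) * fact n))))"
  proof (rule suminf_le)
    fix n
    have "Gamma (\<nu>' + 1/2) / Gamma (\<nu>' + 1/2 + (real n + 1/2))
        \<le> Gamma (\<nu> + 1/2) / Gamma (\<nu> + 1/2 + (real n + 1/2))"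
      using assms by (intro Gamma_ratio_antimono) auto
    then have "Gamma (\<nu>' + 1/2) / Gamma (real n + \<nu>' + 1)
        \<le> Gamma (\<nu> + 1/2) / Gamma (real n + \<nu> + 1)"
      by (simp add: add_ac)
    then have "((x/2) powr (2 * real n + \<nu>') / fact n) * (Gamma (\<nu>' + 1/2) / Gamma (real n + \<nu>' + 1))
        \<le> ((x/2) powr (2 * real n + \<nu>') / fact n) * (Gamma (\<nu> + 1/2) / Gamma (real n + \<nu> + 1))"
      by (rule mult_left_mono) auto
    moreover have "(x/2) powr (2 * real n + \<nu>') = (x/2) powr (\<nu>' - \<nu>) * (x/2) powr (2 * real n + \<nu>)"
      by (simp add: add.commute flip: powr_add)
    ultimately show "Gamma (\<nu>' + 1/2) * ((x/2) powr (2 * real n + \<nu>') / (Gamma (real n + \<nu>' + 1) * fact n))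
        \<le> (x/2) powr (\<nu>' - \<nu>) *
          (Gamma (\<nu> + 1/2) * ((x/2) powr (2 * real n + \<nu>) / (Gamma (real n + \<nu> + 1) * fact n)))"
      by (simp add: mult_ac)
  qed (intro summable_mult s)+
  then show ?thesis
    unfolding bessel_I_def by (simp only: suminf_mult summable_mult s)
qed

section \<open>Absolute convergence of the coefficient series\<close>

text \<open>For \<open>L < q < \<mu> / e\<close>, eventually \<open>\<bar>b n\<bar>\<close> is at
  most \<open>(q n) powr (\<mu> n)\<close>, while the Gamma value grows roughly like
  \<open>(\<mu> n / e) powr (\<mu> n)\<close>. The quotient therefore decays geometrically.\<close>

lemma summable_divide_Gamma:
  fixes b :: "nat \<Rightarrow> real" and \<mu> c L :: real
  assumes \<mu>: "\<mu> > 0"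
    and lim: "(\<lambda>n. \<bar>b n\<bar> powr (1 / (\<mu> * real n)) / real n) \<longlonglongrightarrow> L"
    and L: "L < \<mu> / exp 1"
  shows "summable (\<lambda>n. \<bar>b n / Gamma (\<mu> * real n + c)\<bar>)"
proof -
  have "L \<ge> 0"
    by (rule LIMSEQ_le_const[OF lim]) auto
  obtain q where q: "L < q" "q < \<mu> / exp 1"
    using dense[OF L] by blast
  have "q > 0" using q \<open>L \<ge> 0\<close> by simp
  \<comment> \<open>The shift matches the form \<open>Gamma (w + 1)\<close> of the lower bound, with
    \<open>w = \<mu> n + d\<close>.\<close>
  define d where "d = c - 1"
  \<comment> \<open>The exponential rate of the quotient is \<open>- 2 * \<delta>\<close>; giving up
    half of it absorbs the lower-order terms.\<close>
  define \<delta> where "\<delta> = (\<mu> * ln \<mu> - \<mu> - \<mu> * ln q) / 2"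
  have "ln q < ln (\<mu> / exp 1)"
    using q \<open>q > 0\<close> \<mu> by (subst ln_less_cancel_iff) auto
  then have "\<mu> * ln q < \<mu> * (ln \<mu> - 1)"
    using \<mu> by (simp add: ln_div)
  then have "\<delta> > 0" by (simp add: \<delta>_def algebra_simps)
  \<comment> \<open>\<open>E n\<close> is the logarithm of the upper bound for
    \<open>\<bar>b n\<bar>\<close> divided by the lower bound for the Gamma value.\<close>
  define E where "E n = \<mu> * real n * ln (q * real n) - (\<mu> * real n + d) * ln (\<mu> * real n + d)
    + (\<mu> * real n + d)" for n
  have "((\<lambda>n. E n / real n) \<longlongrightarrow> \<mu> * ln q - \<mu> * ln \<mu> + \<mu>) sequentially"
    unfolding E_def using \<mu> \<open>q > 0\<close> by real_asymp
  then have "\<forall>\<^sub>F n in sequentially. E n / real n < - \<delta>"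
    by (rule order_tendstoD) (use \<open>\<delta> > 0\<close> in \<open>simp add: \<delta>_def field_simps\<close>)
  moreover have "\<forall>\<^sub>F n in sequentially. \<bar>b n\<bar> powr (1 / (\<mu> * real n)) / real n < q"
    using lim q(1) by (rule order_tendstoD)
  moreover have "\<forall>\<^sub>F n in sequentially. \<mu> * real n + d > 0"
    using \<mu> by real_asymp
  ultimately have "\<forall>\<^sub>F n in sequentially. norm \<bar>b n / Gamma (\<mu> * real n + c)\<bar> \<le> exp (- \<delta>) ^ n"
    using eventually_gt_at_top[of 0]
  proof eventually_elim
    case (elim n)
    let ?w = "\<mu> * real n + d"
    have "\<bar>b n\<bar> = (\<bar>b n\<bar> powr (1 / (\<mu> * real n))) powr (\<mu> * real n)"
      using elim \<mu> by (simp add: powr_powr)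
    also have "\<dots> \<le> (q * real n) powr (\<mu> * real n)"
      using elim \<mu> by (intro powr_mono2) (auto simp: field_simps)
    finally have "\<bar>b n\<bar> \<le> exp (\<mu> * real n * ln (q * real n))"
      using elim \<open>q > 0\<close> by (simp add: powr_def)
    moreover have "exp (?w * ln ?w - ?w) \<le> Gamma (\<mu> * real n + c)"
      using Gamma_plus1_ge[of ?w] elim by (simp add: d_def powr_def exp_diff)
    ultimately have "\<bar>b n\<bar> / Gamma (\<mu> * real n + c)
        \<le> exp (\<mu> * real n * ln (q * real n)) / exp (?w * ln ?w - ?w)"
      by (intro frac_le) auto
    also have "\<dots> = exp (E n)" by (simp add: E_def exp_diff exp_add)
    also have "\<dots> \<le> exp (real n * (- \<delta>))" using elim by (simp add: field_simps)
    also have "\<dots> = exp (- \<delta>) ^ n" by (rule exp_of_nat_mult)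
    finally have "\<bar>b n\<bar> / Gamma (\<mu> * real n + c) \<le> exp (- \<delta>) ^ n" .
    moreover have "Gamma (\<mu> * real n + c) > 0"
      using \<open>exp (?w * ln ?w - ?w) \<le> _\<close> exp_gt_zero less_le_trans by blast
    ultimately show ?case by (simp add: abs_divide)
  qed
  moreover have "summable (\<lambda>n. exp (- \<delta>) ^ n)"
    using \<open>\<delta> > 0\<close> by (intro summable_geometric) simp
  ultimately show ?thesis
    by (rule summable_comparison_test_ev)
qed

section \<open>The inner integral\<close>

text \<open>The antiderivative \<open>(s - k) * a s\<close> on \<open>[k, k + 1]\<close> vanishes at
  the left end and equals \<open>a (k + 1)\<close> at the right end, so the sum starts with
  \<open>a 1\<close>.\<close>

lemma
  fixes a a' :: "real \<Rightarrow> real"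
  assumes a: "\<And>s. s \<ge> 0 \<Longrightarrow> (a has_real_derivative a' s) (at s within {0..})"
    and a': "continuous_on {0..} a'"
  shows set_integrable_dd: "set_integrable lborel {0<..<real N} (dd a)"
    and integral_dd: "(LBINT s:{0<..<real N}. dd a s) = (\<Sum>k<N. a (real (Suc k)))"
proof -
  let ?g = "\<lambda>s. a s + frac s * a' s"
  have at: "(a has_real_derivative a' s) (at s)" if "s > 0" for s
    using a[of s] at_within_interior[of s "{0..}"] that by auto
  \<comment> \<open>\<open>dd\<close> uses the two-sided \<open>deriv\<close>, whereas only a
    one-sided derivative is given at 0; the open interval of integration keeps 0 out.\<close>
  have dd_eq: "dd a s = ?g s" if "s > 0" for s
    using DERIV_imp_deriv[OF at[OF that]] by (simp add: dd_def)
  have conta: "continuous_on {0..} a"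
    using a by (auto simp: continuous_on_eq_continuous_within intro: DERIV_continuous)
  have int: "set_integrable lborel {0..real N} ?g"
  proof -
    have 1: "set_integrable lborel {0..real N} a" "set_integrable lborel {0..real N} a'"
      by (auto intro!: borel_integrable_atLeastAtMost' continuous_on_subset[OF conta]
          continuous_on_subset[OF a'])
    \<comment> \<open>\<open>frac\<close> jumps at the integers, so continuity is replaced by
      domination by \<open>a'\<close>, using that \<open>frac s\<close> lies in
      \<open>[0, 1)\<close>.\<close>
    have "set_integrable lborel {0..real N} (\<lambda>s. frac s * a' s)"
      using 1(2) unfolding set_integrable_def
    proof (rule Bochner_Integration.integrable_bound)
      have "(\<lambda>s. frac s * (indicator {0..real N} s *\<^sub>R a' s)) \<in> borel_measurable lborel"
        using borel_measurable_integrable[OF 1(2)[unfolded set_integrable_def]]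
        unfolding frac_def by measurable
      then show "(\<lambda>s. indicator {0..real N} s *\<^sub>R (frac s * a' s)) \<in> borel_measurable lborel"
        by (simp add: mult_ac)
      show "AE s in lborel. norm (indicator {0..real N} s *\<^sub>R (frac s * a' s))
          \<le> norm (indicator {0..real N} s *\<^sub>R a' s)"
        by (intro AE_I2)
          (simp add: abs_mult indicator_def mult_left_le_one_le frac_lt_1 [THEN less_imp_le])
    qed
    with 1(1) show ?thesis by (rule set_integral_add)
  qed
  have "set_integrable lborel {0<..<real N} ?g"
    by (rule set_integrable_subset[OF int]) auto
  then show int': "set_integrable lborel {0<..<real N} (dd a)"
    by (subst set_integrable_cong[OF refl refl dd_eq]) auto
  have "(?g has_integral (\<Sum>k<N. a (real (Suc k)))) {0..real N}"
  proof (induction N)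
    case (Suc N)
    have "((\<lambda>s. a s + frac s * a' s) has_integral
        (real (Suc N) - real N) * a (real (Suc N)) - (real N - real N) * a (real N))
        (cbox (real N) (real (Suc N)))"
    \<comment> \<open>\<open>frac s = s - N\<close> fails at the right endpoint, where
      \<open>frac\<close> drops to 0, so the integrands are compared in the interior only.\<close>
    proof (rule has_integral_spike_interior)
      show "((\<lambda>s. a s + (s - real N) * a' s) has_integral
        (real (Suc N) - real N) * a (real (Suc N)) - (real N - real N) * a (real N))
        (cbox (real N) (real (Suc N)))"
        unfolding cbox_interval
      proof (rule fundamental_theorem_of_calculus_interior)
        show "continuous_on {real N..real (Suc N)} (\<lambda>s. (s - real N) * a s)"
          by (intro continuous_intros continuous_on_subset[OF conta]) auto
        fix s assume s: "s \<in> {real N<..<real (Suc N)}"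
        then have "s > 0" by (auto intro: le_less_trans[of 0 "real N"])
        then show "((\<lambda>s. (s - real N) * a s) has_vector_derivative a s + (s - real N) * a' s) (at s)"
          unfolding has_real_derivative_iff_has_vector_derivative [symmetric]
          by (auto intro!: derivative_eq_intros at)
      qed simp
      fix s assume "s \<in> box (real N) (real (Suc N))"
      then have "\<lfloor>s\<rfloor> = int N" by (auto simp: floor_eq_iff)
      then show "a s + frac s * a' s = a s + (s - real N) * a' s"
        by (simp add: frac_def)
    qed
    then have "(?g has_integral a (real (Suc N))) {real N..real (Suc N)}" by simp
    then show ?case
      using has_integral_combine[OF _ _ Suc] by simp
  qed (simp add: has_integral_refl)
  then have "(?g has_integral (\<Sum>k<N. a (real (Suc k)))) {0<..<real N}"
    by (simp add: has_integral_Icc_iff_Ioo)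
  then have "(dd a has_integral (\<Sum>k<N. a (real (Suc k)))) {0<..<real N}"
    by (rule has_integral_cong[THEN iffD1, rotated]) (simp add: dd_eq)
  then show "(LBINT s:{0<..<real N}. dd a s) = (\<Sum>k<N. a (real (Suc k)))"
    using set_borel_integral_eq_integral(2)[OF int'] by (simp add: integral_unique)
qed

section \<open>Abel summation against a decreasing function\<close>

text \<open>The step function of partial sums is constant between integers, so the integral up to an
  integer is summation by parts. Its boundary term vanishes in the limit because the partial sums
  are bounded and \<open>F\<close> tends to 0. The term \<open>a k\<close> is paired with
  \<open>F (k + 1)\<close>.\<close>

lemma abel_summation_integral:
  fixes F F' :: "real \<Rightarrow> real" and a :: "nat \<Rightarrow> real"
  assumes F: "\<And>u. u \<ge> 1 \<Longrightarrow> (F has_real_derivative F' u) (at u)"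
    and F': "\<And>u. u \<ge> 1 \<Longrightarrow> isCont F' u"
    and mono: "\<And>u v. 1 \<le> u \<Longrightarrow> u \<le> v \<Longrightarrow> F v \<le> F u"
    and F_lim: "(F \<longlongrightarrow> 0) at_top"
    and bound: "\<And>N. \<bar>\<Sum>k<N. a k\<bar> \<le> C"
  shows "set_integrable lborel {1<..} (\<lambda>u. F' u * (\<Sum>k<nat \<lfloor>u\<rfloor>. a k))"
    and "(\<lambda>n. a n * F (real (Suc n))) sums
      (- (LBINT u:{1<..}. F' u * (\<Sum>k<nat \<lfloor>u\<rfloor>. a k)))"
proof -
  define A where "A N = (\<Sum>k<N. a k)" for N
  let ?G = "\<lambda>u. F' u * A (nat \<lfloor>u\<rfloor>)"
  \<comment> \<open>A positive derivative would make \<open>F\<close> strictly larger just to the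
    right of \<open>u\<close>.\<close>
  have F'_le: "F' u \<le> 0" if u: "u > 1" for u
  proof (rule ccontr)
    assume "\<not> F' u \<le> 0"
    then obtain d where d: "d > 0" and inc: "\<And>h. 0 < h \<Longrightarrow> h < d \<Longrightarrow> F u < F (u + h)"
      using DERIV_pos_inc_right[OF F[OF less_imp_le[OF u]]] by (meson not_le)
    have "F u < F (u + d / 2)" using d by (intro inc) auto
    moreover have "F (u + d / 2) \<le> F u" using d u by (intro mono) auto
    ultimately show False by simp
  qed
  have F_cont: "isCont F u" if "u \<ge> 1" for u using F[OF that] by (rule DERIV_isCont)
  have F'_int: "set_integrable lborel {1<..} F'"
  proof -
    \<comment> \<open>Since \<open>- F'\<close> is nonnegative, finite limits of its antiderivative
      \<open>- F\<close> at both ends already give integrability.\<close>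
    have "set_integrable lborel (einterval 1 \<infinity>) (\<lambda>u. - F' u)"
    proof (rule interval_integral_FTC_nonneg)
      show "((\<lambda>u. - F u) has_real_derivative - F' u) (at u)" if "1 < ereal u" for u
        using that by (intro DERIV_minus F) simp
      show "isCont (\<lambda>u. - F' u) u" if "1 < ereal u" for u
        using that by (auto intro!: continuous_intros F')
      show "AE u in lborel. 1 < ereal u \<longrightarrow> ereal u < \<infinity> \<longrightarrow> 0 \<le> - F' u"
        using F'_le by auto
      have "((\<lambda>u. - F u) \<longlongrightarrow> - F 1) (at_right 1)"
        using F_cont[OF order_refl] unfolding isCont_def filterlim_at_split
        by (intro tendsto_minus) (rule conjunct2)
      then show "(((\<lambda>u. - F u) \<circ> real_of_ereal) \<longlongrightarrow> - F 1) (at_right 1)"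
        by (simp add: ereal_tendsto_simps one_ereal_def)
      show "(((\<lambda>u. - F u) \<circ> real_of_ereal) \<longlongrightarrow> 0) (at_left \<infinity>)"
        using tendsto_minus[OF F_lim] by (simp add: ereal_tendsto_simps)
    qed simp
    then have "set_integrable lborel {1<..} (\<lambda>u. - F' u)"
      by (simp add: einterval_def greaterThan_def)
    then show ?thesis by (simp add: set_integrable_def)
  qed
  have G_int: "set_integrable lborel {1<..} ?G"
    unfolding set_integrable_def
  proof (rule Bochner_Integration.integrable_bound)
    show "integrable lborel (\<lambda>u. C *\<^sub>R (indicator {1<..} u *\<^sub>R F' u))"
      using F'_int unfolding set_integrable_def by (rule integrable_scaleR_right)
    have "(\<lambda>u. (indicator {1<..} u *\<^sub>R F' u) * A (nat \<lfloor>u\<rfloor>)) \<in> borel_measurable lborel"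
      using borel_measurable_integrable[OF F'_int[unfolded set_integrable_def]] by measurable
    then show "(\<lambda>u. indicator {1<..} u *\<^sub>R ?G u) \<in> borel_measurable lborel"
      by (simp add: mult_ac)
    have "\<bar>F' u\<bar> * \<bar>A (nat \<lfloor>u\<rfloor>)\<bar> \<le> \<bar>C\<bar> * \<bar>F' u\<bar>" for u
      using mult_left_mono[OF order_trans[OF bound abs_ge_self], of "\<bar>F' u\<bar>" "nat \<lfloor>u\<rfloor>"]
      by (simp add: A_def mult.commute)
    then show "AE u in lborel. norm (indicator {1<..} u *\<^sub>R ?G u)
        \<le> norm (C *\<^sub>R (indicator {1<..} u *\<^sub>R F' u))"
      by (intro AE_I2) (auto simp: indicator_def abs_mult)
  qed
  then show "set_integrable lborel {1<..} (\<lambda>u. F' u * (\<Sum>k<nat \<lfloor>u\<rfloor>. a k))"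
    by (simp only: A_def)
  \<comment> \<open>Adding the null set \<open>{1}\<close> passes to the closed ray, on which the
    integrals over \<open>[1, N + 1]\<close> are taken.\<close>
  have G_int1: "set_integrable lborel {1} ?G" and G_zero1: "(LBINT u:{1}. ?G u) = 0"
  proof -
    have eq: "(\<lambda>u. indicator {1} u *\<^sub>R ?G u) = (\<lambda>u. indicator {1} u *\<^sub>R ?G 1)"
      by (auto simp: indicator_def)
    show "set_integrable lborel {1} ?G" "(LBINT u:{1}. ?G u) = 0"
      unfolding set_integrable_def set_lebesgue_integral_def eq by simp_all
  qed
  have Ici: "{1..} = {1} \<union> {1::real<..}" by auto
  have G_int': "set_integrable lborel {1..} ?G"
    unfolding Ici by (rule set_integrable_Un[OF G_int1 G_int]) simp_all
  have G_eq: "(LBINT u:{1..}. ?G u) = (LBINT u:{1<..}. ?G u)"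
    unfolding Ici using set_integral_Un[OF _ G_int1 G_int] G_zero1 by simp
  have step: "(?G has_integral A (Suc N) * (F (real (Suc N) + 1) - F (real (Suc N))))
      {real (Suc N)..real (Suc N) + 1}" for N
  proof -
    let ?m = "real (Suc N)"
    have "((\<lambda>u. F' u * A (Suc N)) has_integral F (?m + 1) * A (Suc N) - F ?m * A (Suc N)) (cbox ?m (?m + 1))"
      unfolding cbox_interval
    proof (rule fundamental_theorem_of_calculus)
      fix u assume "u \<in> {?m..?m + 1}"
      then have "u \<ge> 1" by simp
      then show "((\<lambda>u. F u * A (Suc N)) has_vector_derivative F' u * A (Suc N)) (at u within {?m..?m + 1})"
        unfolding has_real_derivative_iff_has_vector_derivative [symmetric]
        by (rule has_field_derivative_at_within[OF DERIV_cmult_right[OF F]])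
    qed simp
    then have "(?G has_integral F (?m + 1) * A (Suc N) - F ?m * A (Suc N)) (cbox ?m (?m + 1))"
    \<comment> \<open>At the right endpoint the floor has already jumped to the next
      integer.\<close>
    proof (rule has_integral_spike_interior)
      fix u assume "u \<in> box ?m (?m + 1)"
      then have "\<lfloor>u\<rfloor> = int (Suc N)" by (auto simp: floor_eq_iff)
      then show "?G u = F' u * A (Suc N)" by (simp only: nat_int)
    qed
    then show ?thesis by (simp add: algebra_simps)
  qed
  \<comment> \<open>Starting at \<open>Suc N\<close> makes the base case the degenerate interval
    \<open>[1, 1]\<close>, where \<open>A 1 * F 1\<close> cancels \<open>a 0 * F 1\<close>.\<close>
  have partial: "(?G has_integral A (Suc N) * F (real (Suc N)) - (\<Sum>k<Suc N. a k * F (real (Suc k))))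
      {1..real (Suc N)}" for N
  proof (induction N)
    case 0
    show ?case by (simp add: A_def has_integral_refl)
  next
    case (Suc N)
    have "A (Suc (Suc N)) = A (Suc N) + a (Suc N)" by (simp add: A_def)
    then show ?case
      using has_integral_combine[OF _ _ Suc step] by (simp add: algebra_simps)
  qed
  have LB: "(LBINT u:{1..real (Suc N)}. ?G u) =
      A (Suc N) * F (real (Suc N)) - (\<Sum>k<Suc N. a k * F (real (Suc k)))" for N
    using set_borel_integral_eq_integral(2)[of "{1..real (Suc N)}" ?G] partial
      set_integrable_subset[OF G_int', of "{1..real (Suc N)}"]
    by (simp add: integral_unique)
  have real_Suc: "filterlim (\<lambda>N. real (Suc N)) at_top sequentially"
    by real_asymp
  have "(\<lambda>N. LBINT u:{1..real (Suc N)}. ?G u) \<longlonglongrightarrow> (LBINT u:{1..}. ?G u)"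
    by (rule filterlim_compose[OF tendsto_set_lebesgue_integral_at_top real_Suc])
       (use G_int' in auto)
  moreover have "(\<lambda>N. A (Suc N) * F (real (Suc N))) \<longlonglongrightarrow> 0"
  proof (rule Lim_null_comparison)
    show "\<forall>\<^sub>F N in sequentially. norm (A (Suc N) * F (real (Suc N))) \<le> C * \<bar>F (real (Suc N))\<bar>"
      using mult_right_mono[OF bound abs_ge_zero] by (simp add: A_def abs_mult del: sum.lessThan_Suc)
    show "(\<lambda>N. C * \<bar>F (real (Suc N))\<bar>) \<longlonglongrightarrow> 0"
      using filterlim_compose[OF F_lim real_Suc] by (intro tendsto_mult_right_zero tendsto_rabs_zero)
  qed
  ultimately have "(\<lambda>N. A (Suc N) * F (real (Suc N)) - (LBINT u:{1..real (Suc N)}. ?G u))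
      \<longlonglongrightarrow> 0 - (LBINT u:{1..}. ?G u)"
    by (intro tendsto_diff)
  then have "(\<lambda>N. \<Sum>k<Suc N. a k * F (real (Suc k))) \<longlonglongrightarrow> - (LBINT u:{1..}. ?G u)"
    by (simp only: LB) simp
  then show "(\<lambda>n. a n * F (real (Suc n))) sums
      (- (LBINT u:{1<..}. F' u * (\<Sum>k<nat \<lfloor>u\<rfloor>. a k)))"
    unfolding sums_def G_eq unfolding A_def by (subst (asm) filterlim_sequentially_Suc)
qed

section \<open>The integral representation of the Bessel series\<close>

theorem theorem1:
  fixes \<beta> :: "real \<Rightarrow> real" and \<mu> \<eta> x L :: real
  assumes "C1_halfline \<beta>"
    and "\<mu> > 0"
    and "(\<lambda>n::nat. \<bar>\<beta> (real n)\<bar> powr (1 / (\<mu> * real n)) / real n) \<longlonglongrightarrow> L"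
    and "L < \<mu> / exp 1"
    and "min (\<eta> + 3/2) (\<mu> + \<eta> + 1) > 0"
    and Gamma_defined: "\<forall>u\<ge>1. \<mu> * u + \<eta> + 1/2 \<notin> \<int>\<^sub>\<le>\<^sub>0"
    and "0 < x"
    and "ereal x < 2 * min 1 (inverse (ereal ((exp 1 / \<mu>) powr \<mu>) *
           limsup (\<lambda>n::nat. ereal (real n powr (- \<mu>) * \<bar>\<beta> (real n)\<bar> powr (1 / real n)))))"
  shows "let F = (\<lambda>u. Gamma (\<mu> * u + \<eta> + 1/2) * bessel_I (\<mu> * u + \<eta>) x);
             a = (\<lambda>s. \<beta> s / Gamma (\<mu> * s + \<eta> + 1/2))
         in (\<forall>u>1. set_integrable lborel {0<..<real_of_int \<lfloor>u\<rfloor>} (\<lambda>s. deriv F u * dd a s)) \<and>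
            set_integrable lborel {1<..}
              (\<lambda>u. LBINT s:{0<..<real_of_int \<lfloor>u\<rfloor>}. deriv F u * dd a s) \<and>
            (\<lambda>n::nat. \<beta> (real (Suc n)) * bessel_I (\<mu> * real (Suc n) + \<eta>) x) sums
              (- (LBINT u:{1<..}. LBINT s:{0<..<real_of_int \<lfloor>u\<rfloor>}. deriv F u * dd a s))"
proof -
  note \<mu> = \<open>\<mu> > 0\<close> and x = \<open>0 < x\<close>
  define F where "F u = Gamma (\<mu> * u + \<eta> + 1/2) * bessel_I (\<mu> * u + \<eta>) x" for u
  define a where "a s = \<beta> s / Gamma (\<mu> * s + \<eta> + 1/2)" for s
  have pos: "\<mu> * u + \<eta> > - 1/2" if "u \<ge> 1" for u
  proof -
    have "\<mu> + \<eta> > - 1/2"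
    proof (rule ccontr)
      assume *: "\<not> \<mu> + \<eta> > - 1/2"
      \<comment> \<open>\<open>v\<close> is the zero of the affine argument of \<open>Gamma\<close>;
        if it were at least 1, it would be a pole excluded by \<open>Gamma_defined\<close>.\<close>
      define v where "v = (- 1/2 - \<eta>) / \<mu>"
      have "v \<ge> 1" "\<mu> * v + \<eta> + 1/2 = 0" using * \<mu> by (auto simp: v_def field_simps)
      with Gamma_defined show False by fastforce
    qed
    moreover have "\<mu> * 1 \<le> \<mu> * u" using that \<mu> by (intro mult_left_mono) auto
    ultimately show ?thesis by simp
  qed
  have x2: "x < 2"
  proof -
    let ?m = "inverse (ereal ((exp 1 / \<mu>) powr \<mu>) *
           limsup (\<lambda>n::nat. ereal (real n powr (- \<mu>) * \<bar>\<beta> (real n)\<bar> powr (1 / real n))))"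
    have "2 * min 1 ?m \<le> 2 * 1" by (intro ereal_mult_left_mono) auto
    with assms(8) have "ereal x < 2 * 1" by (rule less_le_trans)
    then show ?thesis by simp
  qed

  obtain \<phi>' where \<phi>: "\<And>\<nu>. \<nu> > - 1/2 \<Longrightarrow>
      ((\<lambda>\<nu>. Gamma (\<nu> + 1/2) * bessel_I \<nu> x) has_real_derivative \<phi>' \<nu>) (at \<nu>)"
    "\<And>\<nu>. \<nu> > - 1/2 \<Longrightarrow> isCont \<phi>' \<nu>"
    using Gamma_bessel_I_C1[OF x] by blast
  define F' where "F' u = \<phi>' (\<mu> * u + \<eta>) * \<mu>" for u
  have F: "(F has_real_derivative F' u) (at u)" if "u \<ge> 1" for u
  proof -
    have "((\<lambda>u. \<mu> * u + \<eta>) has_real_derivative \<mu>) (at u)"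
      by (auto intro!: derivative_eq_intros)
    from DERIV_chain2[OF \<phi>(1)[OF pos[OF that]] this] show ?thesis
      unfolding F_def[abs_def] F'_def .
  qed
  have F': "isCont F' u" if "u \<ge> 1" for u
    unfolding F'_def[abs_def] using pos[OF that]
    by (intro continuous_mult continuous_const isCont_o2[OF _ \<phi>(2)] continuous_add continuous_ident)
  have F_nonneg: "0 \<le> F u" if "u \<ge> 1" for u
    unfolding F_def using Gamma_bessel_I_nonneg[OF pos[OF that] x] by simp
  have F_decay: "F v \<le> (x/2) powr (\<mu> * (v - u)) * F u" if "1 \<le> u" "u \<le> v" for u v
    unfolding F_def using Gamma_bessel_I_decay[OF pos[OF that(1)] _ x, of "\<mu> * v + \<eta>"] that \<mu>
    by (simp add: algebra_simps)
  have F_mono: "F v \<le> F u" if "1 \<le> u" "u \<le> v" for u v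
  proof -
    have "(x/2) powr (\<mu> * (v - u)) \<le> 1"
      using x x2 \<mu> that by (intro powr_le1) auto
    from mult_right_mono[OF this F_nonneg[OF that(1)]] F_decay[OF that] show ?thesis by simp
  qed
  \<comment> \<open>Comparison with \<open>u = 1\<close> squeezes \<open>F\<close> between 0 and an
    exponential, which decays because \<open>ln (x/2) < 0\<close>.\<close>
  have F_lim: "(F \<longlongrightarrow> 0) at_top"
  proof (rule tendsto_sandwich)
    show "\<forall>\<^sub>F u in at_top. 0 \<le> F u"
      using eventually_ge_at_top[of 1] by eventually_elim (rule F_nonneg)
    show "\<forall>\<^sub>F u in at_top. F u \<le> (x/2) powr (\<mu> * (u - 1)) * F 1"
      using eventually_ge_at_top[of 1] by eventually_elim (intro F_decay, auto)
    define l where "l = \<mu> * ln (x/2)"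
    have "ln (x/2) < 0" using x x2 by (subst ln_less_zero_iff) auto
    with \<mu> have "l < 0" by (simp add: l_def mult_pos_neg)
    then have "((\<lambda>u. exp (l * (u - 1))) \<longlongrightarrow> 0) at_top"
      by real_asymp
    then show "((\<lambda>u. (x/2) powr (\<mu> * (u - 1)) * F 1) \<longlongrightarrow> 0) at_top"
      using x by (intro tendsto_mult_left_zero) (simp add: powr_def l_def mult_ac)
  qed simp

  obtain \<beta>' where \<beta>': "\<And>s. s \<ge> 0 \<Longrightarrow> (\<beta> has_real_derivative \<beta>' s) (at s within {0..})"
    "continuous_on {0..} \<beta>'"
    using assms(1) unfolding C1_halfline_def by blast
  \<comment> \<open>For \<open>s\<close> in \<open>[0, 1)\<close> the argument may meet a pole of
    \<open>Gamma\<close>. Division then gives 0, the value of the entire function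
    \<open>rGamma\<close>, so \<open>a\<close> is the product \<open>\<beta> * r\<close> everywhere
    and is C1 on the half-line.\<close>
  define r where "r s = rGamma (\<mu> * s + \<eta> + 1/2)" for s
  define r' where "r' s = Re (deriv rGamma (of_real (\<mu> * s + \<eta> + 1/2))) * \<mu>" for s
  have r: "(r has_real_derivative r' s) (at s within X)" for s X
  proof -
    have "((\<lambda>s. \<mu> * s + \<eta> + 1/2) has_real_derivative \<mu>) (at s)"
      by (auto intro!: derivative_eq_intros)
    from DERIV_chain2[OF has_real_derivative_Re_of_real[OF holomorphic_rGamma open_UNIV] this]
    show ?thesis unfolding r_def[abs_def] r'_def rGamma_complex_of_real Re_complex_of_real
      by (rule has_field_derivative_at_within) auto
  qed
  have r': "continuous_on X r'" for X
  proof (intro continuous_at_imp_continuous_on ballI)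
    fix s
    have "isCont (\<lambda>s. \<mu> * s + \<eta> + 1/2) s" by (intro continuous_intros)
    from isCont_o2[OF this isCont_Re_deriv_of_real[OF holomorphic_rGamma open_UNIV UNIV_I]]
    show "isCont r' s"
      unfolding r'_def[abs_def] by (rule continuous_mult) (rule continuous_const)
  qed
  have a_eq: "a = (\<lambda>s. \<beta> s * r s)"
    by (rule ext) (simp only: a_def r_def rGamma_inverse_Gamma divide_inverse)
  define a' where "a' s = \<beta> s * r' s + \<beta>' s * r s" for s
  have a_deriv: "(a has_real_derivative a' s) (at s within {0..})" if "s \<ge> 0" for s
    unfolding a_eq a'_def by (rule DERIV_mult'[OF \<beta>'(1)[OF that] r])
  have "continuous_on {0..} \<beta>"
    using \<beta>'(1) by (auto simp: continuous_on_eq_continuous_within intro: DERIV_continuous)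
  moreover have "continuous_on {0..} r"
    using r by (auto simp: continuous_on_eq_continuous_within intro: DERIV_continuous)
  ultimately have a'_cont: "continuous_on {0..} a'"
    unfolding a'_def by (intro continuous_on_add continuous_on_mult \<beta>'(2) r')

  have "summable (\<lambda>n. \<bar>a (real n)\<bar>)"
    using summable_divide_Gamma[OF \<mu> assms(3,4), of "\<eta> + 1/2"] by (simp add: a_def add.assoc)
  then have S: "summable (\<lambda>k. \<bar>a (real (Suc k))\<bar>)"
    by (subst summable_Suc_iff)
  have bound: "\<bar>\<Sum>k<N. a (real (Suc k))\<bar> \<le> (\<Sum>k. \<bar>a (real (Suc k))\<bar>)" for N
    by (rule order_trans[OF sum_abs sum_le_suminf[OF S]]) auto
  note abel = abel_summation_integral[OF F F' F_mono F_lim bound, simplified]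

  have dF: "deriv F u = F' u" if "u > 1" for u
    using that by (intro DERIV_imp_deriv F) simp
  have fl: "real_of_int \<lfloor>u\<rfloor> = real (nat \<lfloor>u\<rfloor>)" if "u > 1" for u
    using that by simp
  \<comment> \<open>For fixed \<open>u\<close> the factor \<open>deriv F u\<close> is constant in
    \<open>s\<close>, which leaves the partial sum up to \<open>[u]\<close>.\<close>
  have inner: "(LBINT s:{0<..<real_of_int \<lfloor>u\<rfloor>}. deriv F u * dd a s) =
      F' u * (\<Sum>k<nat \<lfloor>u\<rfloor>. a (real (Suc k)))" if "u > 1" for u
    unfolding dF[OF that] fl[OF that] set_integral_mult_right
    by (subst integral_dd[OF a_deriv a'_cont]) auto
  \<comment> \<open>At arguments at least 1 the Gamma factors of \<open>a\<close> and
    \<open>F\<close> are positive and cancel.\<close>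
  have "a (real (Suc n)) * F (real (Suc n)) = \<beta> (real (Suc n)) * bessel_I (\<mu> * real (Suc n) + \<eta>) x" for n
  proof -
    have "Gamma (\<mu> * real (Suc n) + \<eta> + 1/2) \<noteq> 0"
      using pos[of "real (Suc n)"]
      by (intro less_imp_neq[symmetric] Gamma_real_pos) (simp del: of_nat_Suc)
    then show ?thesis by (simp add: a_def F_def del: of_nat_Suc)
  qed
  with abel(2) have "(\<lambda>n. \<beta> (real (Suc n)) * bessel_I (\<mu> * real (Suc n) + \<eta>) x) sums
      (- (LBINT u:{1<..}. F' u * (\<Sum>k<nat \<lfloor>u\<rfloor>. a (real (Suc k)))))"
    by simp
  moreover have "(LBINT u:{1<..}. LBINT s:{0<..<real_of_int \<lfloor>u\<rfloor>}. deriv F u * dd a s) =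
      (LBINT u:{1<..}. F' u * (\<Sum>k<nat \<lfloor>u\<rfloor>. a (real (Suc k))))"
    by (intro set_lebesgue_integral_cong allI impI inner) simp_all
  moreover have "set_integrable lborel {1<..}
      (\<lambda>u. LBINT s:{0<..<real_of_int \<lfloor>u\<rfloor>}. deriv F u * dd a s)"
    using abel(1) by (subst set_integrable_cong[OF refl refl inner]) auto
  moreover have "set_integrable lborel {0<..<real_of_int \<lfloor>u\<rfloor>} (\<lambda>s. deriv F u * dd a s)" if "u > 1" for u
    unfolding fl[OF that] by (intro set_integrable_mult_right impI set_integrable_dd[OF a_deriv a'_cont])
  ultimately show ?thesis
    unfolding Let_def F_def[abs_def, symmetric] a_def[abs_def, symmetric] by auto
qed

end
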